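(* Let $d\in\{2,3\}$, $\alpha>0$, $\beta\in\mathbb R$, let $\mathbf n\in\mathbb R^d$ be a unit vector, $\mathbb A:=\alpha\mathbb I+\beta\,\mathbf n\otimes\mathbf n\in\mathbb R^{d\times d}$, $\gamma:=\operatorname{tr}\mathbb A/|\mathbb A|_F^2$, and let $C_R\ge1$. Then $$|\gamma\mathbb A-\mathbb I|_F^2=(d-1)\,\beta^2\,|\mathbb A|_F^{-2}.$$ Further, $C_R\,|\gamma\mathbb A-\mathbb I|_F<1$ if and only if $$\beta\in\left(\alpha\mu^{-1}(1-\sqrt{1+d\mu}),\ \alpha\mu^{-1}(1+\sqrt{1+d\mu})\right),\qquad \mu:=C_R^2(d-1)-1,$$ where, for $\mu=0$, the interval is understood in the sense of the limit $\mu\to0^+$.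
   Context: $|\cdot|_F$ is the Frobenius norm and $\mathbb I$ the $d\times d$ identity matrix. For $\mu=0$ (i.e. $d=2$, $C_R=1$) the limiting interval is $(-\alpha,\infty)$. *)

theory Defs
  imports "HOL-Analysis.Analysis" "HOL-Real_Asymp.Real_Asymp"
begin

definition frobenius_norm :: "real^'n^'m \<Rightarrow> real" where
  "frobenius_norm A = sqrt (\<Sum>i\<in>UNIV. \<Sum>j\<in>UNIV. (A $ i $ j)\<^sup>2)"

lemma frobenius_norm_eq_norm: "frobenius_norm A = norm A"
  by (simp add: frobenius_norm_def norm_vec_def L2_set_def sum_nonneg)

definition outer_product :: "real^'m \<Rightarrow> real^'n \<Rightarrow> real^'n^'m" where
  "outer_product u v = (\<chi> i j. u $ i * v $ j)"

definition lower_end :: "real \<Rightarrow> real \<Rightarrow> real \<Rightarrow> real" where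
  "lower_end d \<alpha> \<mu> = \<alpha> * inverse \<mu> * (1 - sqrt (1 + d * \<mu>))"

definition upper_end :: "real \<Rightarrow> real \<Rightarrow> real \<Rightarrow> real" where
  "upper_end d \<alpha> \<mu> = \<alpha> * inverse \<mu> * (1 + sqrt (1 + d * \<mu>))"

(* At \<mu> = 0 the endpoints are the limits as \<mu> tends to 0 from the right. These are taken in
   ereal because the upper one is infinite; limit_interval_zero computes the resulting set. *)
definition beta_interval :: "real \<Rightarrow> real \<Rightarrow> real \<Rightarrow> real set" where
  "beta_interval d \<alpha> \<mu> =
     (if \<mu> = 0
      then {\<beta>. Lim (at_right 0) (\<lambda>m. ereal (lower_end d \<alpha> m)) < ereal \<beta> \<and>
               ereal \<beta> < Lim (at_right 0) (\<lambda>m. ereal (upper_end d \<alpha> m))}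
      else {lower_end d \<alpha> \<mu><..<upper_end d \<alpha> \<mu>})"

lemma limit_interval_zero:
  assumes "\<alpha> > 0" "d > 0"
  shows "beta_interval d \<alpha> 0 = {- (d * \<alpha> / 2)<..}"
proof -
  have "((\<lambda>m. lower_end d \<alpha> m) \<longlongrightarrow> - (d * \<alpha> / 2)) (at_right 0)"
    unfolding lower_end_def using assms by (real_asymp simp: field_simps)
  then have 1: "Lim (at_right 0) (\<lambda>m. ereal (lower_end d \<alpha> m)) = ereal (- (d * \<alpha> / 2))"
    by (intro tendsto_Lim) (simp_all add: tendsto_ereal del: uminus_ereal.simps)
  have "filterlim (\<lambda>m. upper_end d \<alpha> m) at_top (at_right 0)"
    unfolding upper_end_def using assms by real_asymp
  then have 2: "Lim (at_right 0) (\<lambda>m. ereal (upper_end d \<alpha> m)) = \<infinity>"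
    by (intro tendsto_Lim) (simp_all add: tendsto_PInfty_eq_at_top)
  show ?thesis unfolding beta_interval_def using 1 2 by auto
qed

end

theory Submission
  imports Defs
begin

text \<open>
  With \<open>F = |A|\<^sup>2\<close> and \<open>t = tr A = \<langle>A, I\<rangle>\<close>, the matrix \<open>\<gamma> A\<close> is the orthogonal projection of \<open>I\<close> onto the
  line spanned by \<open>A\<close>, so \<open>|\<gamma> A - I|\<^sup>2 = d - t\<^sup>2 / F\<close>, and \<open>d F - t\<^sup>2 = (d - 1) \<beta>\<^sup>2\<close>.
  The condition \<open>C\<^sub>R |\<gamma> A - I| < 1\<close> then becomes the quadratic inequality
  \<open>\<mu> \<beta>\<^sup>2 - 2 \<alpha> \<beta> - d \<alpha>\<^sup>2 < 0\<close>, whose roots are the endpoints of the interval.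
\<close>

text \<open>The inner product of matrices is the Frobenius one, so the trace in
  \<open>\<gamma>\<close> can be read as the numerator of a projection coefficient.\<close>

lemma inner_mat_1: "A \<bullet> mat 1 = trace (A :: real^'n^'n)"
proof -
  have "A \<bullet> mat 1 = (\<Sum>i\<in>UNIV. \<Sum>j\<in>UNIV. A $ i $ j * (if i = j then 1 else 0))"
    by (simp add: inner_vec_def mat_def)
  also have "\<dots> = trace A"
    by (simp add: trace_def if_distrib cong: if_cong)
  finally show ?thesis .
qed

lemma inner_outer_product:
  fixes u u' :: "real^'m" and v v' :: "real^'n"
  shows "outer_product u v \<bullet> outer_product u' v' = (u \<bullet> u') * (v \<bullet> v')"
  by (simp add: inner_vec_def outer_product_def sum_product algebra_simps)

lemma trace_outer_product: "trace (outer_product u v) = u \<bullet> (v :: real^'n)"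
  by (simp add: trace_def outer_product_def inner_vec_def)

lemma norm_mat_1_sq: "(norm (mat 1 :: real^'n^'n))\<^sup>2 = real CARD('n)"
  by (simp add: power2_norm_eq_inner inner_mat_1 trace_I)

text \<open>Pythagoras for the projection of \<open>b\<close> onto the line through
  \<open>a\<close>. For \<open>a = 0\<close> the quotients are 0 by convention, and both sides are
  the squared norm of \<open>b\<close>.\<close>

lemma norm_projection_residual_sq:
  fixes a b :: "'a::real_inner"
  shows "(norm (((a \<bullet> b) / (norm a)\<^sup>2) *\<^sub>R a - b))\<^sup>2 = (norm b)\<^sup>2 - (a \<bullet> b)\<^sup>2 / (norm a)\<^sup>2"
proof (cases "a = 0")
  case False
  define c where "c = (a \<bullet> b) / (norm a)\<^sup>2"
  have c: "c * (a \<bullet> a) = a \<bullet> b"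
    using False by (simp add: c_def power2_norm_eq_inner)
  \<comment> \<open>The nesting keeps \<open>c * (a \<bullet> a)\<close> as a subterm, which fact
    \<open>c\<close> then collapses to \<open>a \<bullet> b\<close>.\<close>
  have "(norm (c *\<^sub>R a - b))\<^sup>2 = c * (c * (a \<bullet> a)) - 2 * c * (a \<bullet> b) + b \<bullet> b"
    by (simp add: power2_norm_eq_inner inner_diff_left inner_diff_right inner_commute[of b a]
        algebra_simps)
  also have "\<dots> = (norm b)\<^sup>2 - c * (a \<bullet> b)"
    by (simp add: c power2_norm_eq_inner)
  finally show ?thesis
    by (simp add: c_def power2_eq_square)
qed simp

text \<open>Multiplying by \<open>\<mu>\<close> completes the square: the left side becomes
  \<open>(\<mu> * \<beta> - \<alpha>)\<^sup>2 - \<alpha>\<^sup>2 * (1 + d * \<mu>)\<close>.\<close>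

lemma quadratic_neg_iff_between_roots:
  fixes \<mu> \<alpha> \<beta> d :: real
  assumes "\<mu> > 0" "d \<ge> 0"
  shows "\<mu> * \<beta>\<^sup>2 - 2 * \<alpha> * \<beta> - d * \<alpha>\<^sup>2 < 0 \<longleftrightarrow> \<bar>\<mu> * \<beta> - \<alpha>\<bar> < \<bar>\<alpha>\<bar> * sqrt (1 + d * \<mu>)"
proof -
  have "\<mu> * \<beta>\<^sup>2 - 2 * \<alpha> * \<beta> - d * \<alpha>\<^sup>2 < 0 \<longleftrightarrow> \<mu> * (\<mu> * \<beta>\<^sup>2 - 2 * \<alpha> * \<beta> - d * \<alpha>\<^sup>2) < 0"
    using \<open>\<mu> > 0\<close> by (simp add: mult_less_0_iff)
  also have "\<dots> \<longleftrightarrow> (\<mu> * \<beta> - \<alpha>)\<^sup>2 < \<alpha>\<^sup>2 * (1 + d * \<mu>)"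
    by (simp add: power2_eq_square algebra_simps)
  also have "\<dots> \<longleftrightarrow> sqrt ((\<mu> * \<beta> - \<alpha>)\<^sup>2) < sqrt (\<alpha>\<^sup>2 * (1 + d * \<mu>))"
    by (simp only: real_sqrt_less_iff)
  finally show ?thesis
    by (simp add: real_sqrt_mult)
qed

text \<open>The quadratic form also covers the limit case: at \<open>\<mu> = 0\<close> it
  degenerates to a linear inequality with the single root \<open>- (d * \<alpha> / 2)\<close>, the
  limit of the lower end.\<close>

lemma mem_beta_interval_iff:
  fixes \<mu> \<alpha> \<beta> d :: real
  assumes "\<mu> \<ge> 0" "\<alpha> > 0" "d > 0"
  shows "\<beta> \<in> beta_interval d \<alpha> \<mu> \<longleftrightarrow> \<mu> * \<beta>\<^sup>2 - 2 * \<alpha> * \<beta> - d * \<alpha>\<^sup>2 < 0"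
proof (cases "\<mu> = 0")
  case True
  have "\<mu> * \<beta>\<^sup>2 - 2 * \<alpha> * \<beta> - d * \<alpha>\<^sup>2 = - (\<alpha> * (2 * \<beta> + d * \<alpha>))"
    by (simp add: True power2_eq_square algebra_simps)
  moreover have "\<beta> \<in> beta_interval d \<alpha> \<mu> \<longleftrightarrow> 2 * \<beta> + d * \<alpha> > 0"
    unfolding True limit_interval_zero[OF \<open>\<alpha> > 0\<close> \<open>d > 0\<close>] by auto
  ultimately show ?thesis
    using \<open>\<alpha> > 0\<close> by (simp add: zero_less_mult_iff)
next
  case False
  with assms have "\<mu> > 0" by simp
  define s where "s = sqrt (1 + d * \<mu>)"
  have "\<beta> \<in> beta_interval d \<alpha> \<mu> \<longleftrightarrow> \<alpha> * (1 - s) / \<mu> < \<beta> \<and> \<beta> < \<alpha> * (1 + s) / \<mu>"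
    using \<open>\<mu> > 0\<close>
    by (simp add: beta_interval_def lower_end_def upper_end_def s_def divide_inverse mult_ac)
  \<comment> \<open>The interval has centre \<open>\<alpha> / \<mu>\<close> and half-width
    \<open>\<alpha> * s / \<mu>\<close>.\<close>
  also have "\<dots> \<longleftrightarrow> \<bar>\<mu> * \<beta> - \<alpha>\<bar> < \<alpha> * s"
    using \<open>\<mu> > 0\<close>
    by (auto simp: pos_divide_less_eq pos_less_divide_eq abs_less_iff algebra_simps)
  finally show ?thesis
    using quadratic_neg_iff_between_roots[of \<mu> d \<beta> \<alpha>] \<open>\<mu> > 0\<close> assms by (simp add: s_def)
qed

theorem lemma6:
  fixes \<alpha> \<beta> \<gamma> \<mu> C\<^sub>R :: real
    and n :: "real^'d"
    and A :: "real^'d^'d"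
  assumes "CARD('d) \<in> {2, 3}"
    and "\<alpha> > 0"
    and "norm n = 1"
    and "A = \<alpha> *\<^sub>R mat 1 + \<beta> *\<^sub>R outer_product n n"
    and "\<gamma> = trace A / (frobenius_norm A)\<^sup>2"
    and "C\<^sub>R \<ge> 1"
    and "\<mu> = C\<^sub>R\<^sup>2 * (real CARD('d) - 1) - 1"
  shows "(frobenius_norm (\<gamma> *\<^sub>R A - mat 1))\<^sup>2
           = (real CARD('d) - 1) * \<beta>\<^sup>2 * frobenius_norm A powi (-2)
       \<and> (C\<^sub>R * frobenius_norm (\<gamma> *\<^sub>R A - mat 1) < 1
            \<longleftrightarrow> \<beta> \<in> beta_interval (real CARD('d)) \<alpha> \<mu>)"
proof -
  define d where "d = real CARD('d)"
  define F where "F = (norm A)\<^sup>2"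
  have d2: "d \<ge> 2"
    using assms(1) by (auto simp: d_def)
  have nn: "n \<bullet> n = 1"
    using \<open>norm n = 1\<close> by (simp add: norm_eq_1)
  have tr: "trace A = d * \<alpha> + \<beta>"
    unfolding inner_mat_1[symmetric] assms(4) inner_add_left inner_scaleR_left
    by (simp add: inner_mat_1 trace_I trace_outer_product nn d_def)
  \<comment> \<open>Bilinear expansion: \<open>mat 1\<close> has squared norm \<open>d\<close>,
    \<open>outer_product n n\<close> has squared norm 1, and their inner product is 1.\<close>
  have F: "F = d * \<alpha>\<^sup>2 + 2 * \<alpha> * \<beta> + \<beta>\<^sup>2"
    unfolding F_def assms(4) power2_norm_eq_inner
    by (simp add: inner_outer_product inner_mat_1
        tr[unfolded assms(4)] inner_commute[of "mat 1"] trace_I trace_outer_product nn d_def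
        power2_eq_square algebra_simps)
  \<comment> \<open>This form stays positive even when \<open>\<beta> = - \<alpha>\<close>.\<close>
  also have "\<dots> = (\<alpha> + \<beta>)\<^sup>2 + (d - 1) * \<alpha>\<^sup>2"
    by (simp add: power2_eq_square algebra_simps)
  also have "\<dots> > 0"
    using d2 \<open>\<alpha> > 0\<close> by (intro add_nonneg_pos) auto
  finally have "F > 0" .
  have "(norm (\<gamma> *\<^sub>R A - mat 1))\<^sup>2 = d - (d * \<alpha> + \<beta>)\<^sup>2 / F"
    using norm_projection_residual_sq[of A "mat 1"]
    by (simp add: assms(5) frobenius_norm_eq_norm inner_mat_1 norm_mat_1_sq tr d_def F_def)
  also have "\<dots> = (d * F - (d * \<alpha> + \<beta>)\<^sup>2) / F"
    using \<open>F > 0\<close> by (simp add: field_simps)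
  also have "d * F - (d * \<alpha> + \<beta>)\<^sup>2 = (d - 1) * \<beta>\<^sup>2"
    by (simp add: F power2_eq_square algebra_simps)
  finally have res: "(norm (\<gamma> *\<^sub>R A - mat 1))\<^sup>2 = (d - 1) * \<beta>\<^sup>2 / F" .
  have "C\<^sub>R\<^sup>2 \<ge> 1"
    using \<open>C\<^sub>R \<ge> 1\<close> by simp
  then have "\<mu> \<ge> 0"
    using mult_mono[of 1 "C\<^sub>R\<^sup>2" 1 "d - 1"] d2 by (simp add: assms(7) d_def)
  \<comment> \<open>Both sides are nonnegative, so squaring is an equivalence and \<open>res\<close>
    becomes applicable.\<close>
  have "C\<^sub>R * norm (\<gamma> *\<^sub>R A - mat 1) < 1 \<longleftrightarrow> (C\<^sub>R * norm (\<gamma> *\<^sub>R A - mat 1))\<^sup>2 < 1"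
    using \<open>C\<^sub>R \<ge> 1\<close> by (simp add: abs_square_less_1)
  also have "\<dots> \<longleftrightarrow> C\<^sub>R\<^sup>2 * (d - 1) * \<beta>\<^sup>2 < F"
    using \<open>F > 0\<close> by (simp add: res field_simps)
  \<comment> \<open>Moving the \<open>\<beta>\<^sup>2\<close> of \<open>F\<close> to the left
    produces the \<open>- 1\<close> in \<open>\<mu>\<close>.\<close>
  also have "\<dots> \<longleftrightarrow> \<mu> * \<beta>\<^sup>2 - 2 * \<alpha> * \<beta> - d * \<alpha>\<^sup>2 < 0"
    unfolding F assms(7) d_def[symmetric] by (simp add: algebra_simps)
  also have "\<dots> \<longleftrightarrow> \<beta> \<in> beta_interval d \<alpha> \<mu>"
    using mem_beta_interval_iff[of \<mu> \<alpha> d \<beta>] \<open>\<mu> \<ge> 0\<close> \<open>\<alpha> > 0\<close> d2 by simp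
  finally show ?thesis
    using res
    by (simp add: frobenius_norm_eq_norm d_def F_def power_int_minus divide_inverse)
qed

end
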